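(* Let $\Gamma$ be a connected finite simple graph with minimum vertex degree at least $2$ and first Betti number $b_1\geq 2$. Then $\ker(\phi^1_\Gamma)$ is trivial, i.e. $\mathcal{H}^1(\Gamma)\cong\mathrm{Aut}(\Gamma)$.
   Context: $b_1$ is the number of independent cycles of $\Gamma$. $\Omega^1(\Gamma)$ is the real vector space of functions $f$ on ordered pairs $(v,w)$ of adjacent vertices with $f(v,w)=-f(w,v)$; the coboundary $D$ maps a vertex function $u$ to $Du(v,w)=u(w)-u(v)$; $H^1(\Gamma)=\Omega^1(\Gamma)/\mathrm{Im}(D)$. Each $g\in\mathrm{Aut}(\Gamma)$ acts by pullback $g^*f(v,w)=f(g(v),g(w))$, which descends to $H^1(\Gamma)$. $\phi^1_\Gamma:\mathrm{Aut}(\Gamma)\to GL(H^1(\Gamma))$ is the homomorphism $\phi^1_\Gamma(g)=(g^* )^{-1}$ and $\mathcal{H}^1(\Gamma)$ is its image. *)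

theory Defs
  imports
    "Graph_Theory.Graph_Theory"
    "HOL-Algebra.Algebraic_Closure_Type"
    "HOL-Algebra.Bij"
    "HOL-Algebra.AbelCoset"
    "HOL-Library.Function_Algebras"
begin

text \<open>
  Finite simple graphs are the \<^locale>\<open>pair_graph\<close>s of the AFP entry Graph Theory: an edge
  between \<open>v\<close> and \<open>w\<close> is the pair of opposite arcs \<open>(v, w)\<close>, \<open>(w, v)\<close>, so the set of arcs
  \<open>parcs G\<close> is the set of ordered pairs of adjacent vertices and \<open>out_degree\<close> is the vertex
  degree.
\<close>

abbreviation real_field :: "real ring"
  where "real_field \<equiv> ring_of_type_algebra"


section \<open>Quotient modules and general linear groups\<close>

text \<open>A module record has (unused) fields for a multiplication and its unit.\<close>

definition quotient_module :: "('c, 'm) module \<Rightarrow> 'm set \<Rightarrow> ('c, 'm set) module" where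
  "quotient_module M N =
    \<lparr>carrier = a_rcosets\<^bsub>M\<^esub> N, mult = undefined, one = undefined,
     zero = N, add = set_add M,
     module.smult = (\<lambda>c C. \<Union>x\<in>C. N +>\<^bsub>M\<^esub> (c \<odot>\<^bsub>M\<^esub> x))\<rparr>"

definition GL :: "('c, 'r) ring_scheme \<Rightarrow> ('c, 'm, 's) module_scheme \<Rightarrow> ('m \<Rightarrow> 'm) monoid" where
  "GL R M = (BijGroup (carrier M))
    \<lparr>carrier := {h \<in> Bij (carrier M).
      (\<forall>x\<in>carrier M. \<forall>y\<in>carrier M. h (x \<oplus>\<^bsub>M\<^esub> y) = h x \<oplus>\<^bsub>M\<^esub> h y) \<and>
      (\<forall>c\<in>carrier R. \<forall>x\<in>carrier M. h (c \<odot>\<^bsub>M\<^esub> x) = c \<odot>\<^bsub>M\<^esub> h x)}\<rparr>"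


section \<open>Automorphisms, 1-forms and cohomology of a graph\<close>

definition Aut :: "'a pair_pre_digraph \<Rightarrow> ('a \<Rightarrow> 'a) monoid" where
  "Aut G = (BijGroup (pverts G))
    \<lparr>carrier := {g \<in> Bij (pverts G).
      \<forall>v\<in>pverts G. \<forall>w\<in>pverts G. (g v, g w) \<in> parcs G \<longleftrightarrow> (v, w) \<in> parcs G}\<rparr>"

text \<open>Functions on the arcs are represented by functions on all pairs that vanish off the arcs.\<close>

definition Omega1 :: "'a pair_pre_digraph \<Rightarrow> (real, 'a \<times> 'a \<Rightarrow> real) module" where
  "Omega1 G =
    \<lparr>carrier = {f. (\<forall>(v, w)\<in>parcs G. f (v, w) = - f (w, v)) \<and> (\<forall>e. e \<notin> parcs G \<longrightarrow> f e = 0)},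
     mult = undefined, one = undefined, zero = 0, add = (+), module.smult = (\<lambda>c f e. c * f e)\<rparr>"

definition coboundary :: "'a pair_pre_digraph \<Rightarrow> ('a \<Rightarrow> real) \<Rightarrow> 'a \<times> 'a \<Rightarrow> real" where
  "coboundary G u = (\<lambda>(v, w). if (v, w) \<in> parcs G then u w - u v else 0)"

definition H1 :: "'a pair_pre_digraph \<Rightarrow> (real, ('a \<times> 'a \<Rightarrow> real) set) module" where
  "H1 G = quotient_module (Omega1 G) (range (coboundary G))"

definition pullback :: "'a pair_pre_digraph \<Rightarrow> ('a \<Rightarrow> 'a) \<Rightarrow> ('a \<times> 'a \<Rightarrow> real) \<Rightarrow> 'a \<times> 'a \<Rightarrow> real" where
  "pullback G g f = (\<lambda>(v, w). if (v, w) \<in> parcs G then f (g v, g w) else 0)"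

text \<open>
  The map induced on cohomology: the class of \<open>f\<close> is sent to the class of \<open>pullback G g f\<close>
  (see \<open>pullback_H1_class\<close> below).
\<close>

definition pullback_H1 ::
    "'a pair_pre_digraph \<Rightarrow> ('a \<Rightarrow> 'a) \<Rightarrow> ('a \<times> 'a \<Rightarrow> real) set \<Rightarrow> ('a \<times> 'a \<Rightarrow> real) set" where
  "pullback_H1 G g =
    (\<lambda>C\<in>carrier (H1 G). \<Union>f\<in>C. range (coboundary G) +>\<^bsub>Omega1 G\<^esub> pullback G g f)"

definition phi1 ::
    "'a pair_pre_digraph \<Rightarrow> ('a \<Rightarrow> 'a) \<Rightarrow> ('a \<times> 'a \<Rightarrow> real) set \<Rightarrow> ('a \<times> 'a \<Rightarrow> real) set" where
  "phi1 G g = inv\<^bsub>GL real_field (H1 G)\<^esub> (pullback_H1 G g)"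

definition phi1_image :: "'a pair_pre_digraph \<Rightarrow> (('a \<times> 'a \<Rightarrow> real) set \<Rightarrow> ('a \<times> 'a \<Rightarrow> real) set) monoid"
  where "phi1_image G = (GL real_field (H1 G))\<lparr>carrier := phi1 G ` carrier (Aut G)\<rparr>"


section \<open>The first Betti number\<close>

text \<open>
  The number of independent cycles is the dimension of the space spanned by the oriented
  indicators of the cycles. The length condition excludes the closed walks that traverse one
  edge back and forth, which \<open>cycle\<close> admits.
\<close>

definition cycle_form :: "('a \<times> 'a) list \<Rightarrow> 'a \<times> 'a \<Rightarrow> real" where
  "cycle_form p = (\<lambda>(v, w). real (count_list p (v, w)) - real (count_list p (w, v)))"

definition betti1 :: "'a pair_pre_digraph \<Rightarrow> nat" where
  "betti1 G = vector_space.dim (\<lambda>(c::real) f e. c * f e)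
    {cycle_form p |p. pre_digraph.cycle (with_proj G) p \<and> 3 \<le> length p}"


section \<open>Well-definedness\<close>

lemma vector_space_pointwise: "vector_space (\<lambda>(c::real) (f :: 'b \<Rightarrow> real) e. c * f e)"
  by unfold_locales (auto simp: fun_eq_iff algebra_simps)

lemma real_field_simps [simp]:
  "carrier real_field = UNIV" "a \<otimes>\<^bsub>real_field\<^esub> b = a * b" "a \<oplus>\<^bsub>real_field\<^esub> b = a + b"
  "\<one>\<^bsub>real_field\<^esub> = 1" "\<zero>\<^bsub>real_field\<^esub> = 0"
  by (simp_all add: ring_of_type_algebra_def)

lemma group_Aut:
  fixes G :: "'a pair_pre_digraph"
  shows "group (Aut G)"
proof -
  interpret B: group "BijGroup (pverts G)" by (rule group_BijGroup)
  have "subgroup (carrier (Aut G)) (BijGroup (pverts G))"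
  proof (rule B.subgroupI)
    show "carrier (Aut G) \<subseteq> carrier (BijGroup (pverts G))"
      by (auto simp: Aut_def BijGroup_def)
    have "(\<lambda>x\<in>pverts G. x) \<in> carrier (Aut G)"
      by (auto simp: Aut_def id_Bij)
    then show "carrier (Aut G) \<noteq> {}" by blast
  next
    fix g assume g: "g \<in> carrier (Aut G)"
    then have gB: "g \<in> Bij (pverts G)" by (simp add: Aut_def)
    have eq: "inv\<^bsub>BijGroup (pverts G)\<^esub> g = (\<lambda>x\<in>pverts G. inv_into (pverts G) g x)"
      by (rule inv_BijGroup[OF gB])
    have "(inv_into (pverts G) g v, inv_into (pverts G) g w) \<in> parcs G \<longleftrightarrow> (v, w) \<in> parcs G"
      if "v \<in> pverts G" "w \<in> pverts G" for v w
    proof -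
      have "g ` pverts G = pverts G" using gB by (auto simp: Bij_def bij_betw_def)
      then have "g (inv_into (pverts G) g v) = v" "g (inv_into (pverts G) g w) = w"
        using that by (auto intro: f_inv_into_f)
      moreover have "inv_into (pverts G) g v \<in> pverts G" "inv_into (pverts G) g w \<in> pverts G"
        using gB that by (auto intro: Bij_inv_into_mem)
      ultimately show ?thesis using g by (force simp: Aut_def)
    qed
    then show "inv\<^bsub>BijGroup (pverts G)\<^esub> g \<in> carrier (Aut G)"
      unfolding eq using restrict_inv_into_Bij[OF gB] by (simp add: Aut_def)
  next
    fix g h assume gh: "g \<in> carrier (Aut G)" "h \<in> carrier (Aut G)"
    then have "g \<in> Bij (pverts G)" "h \<in> Bij (pverts G)" by (auto simp: Aut_def)
    moreover from this have "h v \<in> pverts G" if "v \<in> pverts G" for v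
      using that by (auto dest: Bij_imp_funcset)
    ultimately show "g \<otimes>\<^bsub>BijGroup (pverts G)\<^esub> h \<in> carrier (Aut G)"
      using gh by (auto simp: Aut_def BijGroup_def compose_Bij compose_eq)
  qed
  then have "group ((BijGroup (pverts G))\<lparr>carrier := carrier (Aut G)\<rparr>)"
    by (rule B.subgroup_imp_group)
  then show ?thesis by (simp add: Aut_def)
qed

lemma group_GL:
  assumes "module R M"
  shows "group (GL R M)"
proof -
  interpret module R M by fact
  let ?S = "carrier M"
  interpret B: group "BijGroup ?S" by (rule group_BijGroup)
  have "subgroup (carrier (GL R M)) (BijGroup ?S)"
  proof (rule B.subgroupI)
    show "carrier (GL R M) \<subseteq> carrier (BijGroup ?S)"
      by (auto simp: GL_def BijGroup_def)
    have "(\<lambda>x\<in>?S. x) \<in> carrier (GL R M)"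
      by (auto simp: GL_def id_Bij)
    then show "carrier (GL R M) \<noteq> {}" by blast
  next
    fix g assume g: "g \<in> carrier (GL R M)"
    then have gB: "g \<in> Bij ?S" by (simp add: GL_def)
    define k where "k = inv_into ?S g"
    have eq: "inv\<^bsub>BijGroup ?S\<^esub> g = (\<lambda>x\<in>?S. k x)"
      unfolding k_def by (rule inv_BijGroup[OF gB])
    have inj: "inj_on g ?S" and img: "g ` ?S = ?S" using gB by (auto simp: Bij_def bij_betw_def)
    have gk: "g (k x) = x" "k x \<in> ?S" if "x \<in> ?S" for x
      using that img unfolding k_def by (auto intro: f_inv_into_f Bij_inv_into_mem[OF gB])
    have kg: "k y = x" if "g x = y" "x \<in> ?S" for x y
      using that inj unfolding k_def by auto
    have "k (x \<oplus>\<^bsub>M\<^esub> y) = k x \<oplus>\<^bsub>M\<^esub> k y" if "x \<in> ?S" "y \<in> ?S" for x y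
      using that g gk by (intro kg) (auto simp: GL_def)
    moreover have "k (c \<odot>\<^bsub>M\<^esub> x) = c \<odot>\<^bsub>M\<^esub> k x" if "c \<in> carrier R" "x \<in> ?S" for c x
      using that g gk by (intro kg) (auto simp: GL_def)
    ultimately show "inv\<^bsub>BijGroup ?S\<^esub> g \<in> carrier (GL R M)"
      unfolding eq using restrict_inv_into_Bij[OF gB, folded k_def] by (simp add: GL_def)
  next
    fix g h assume gh: "g \<in> carrier (GL R M)" "h \<in> carrier (GL R M)"
    then have "g \<in> Bij ?S" "h \<in> Bij ?S" by (auto simp: GL_def)
    moreover from this have "h x \<in> ?S" if "x \<in> ?S" for x using that by (auto dest: Bij_imp_funcset)
    ultimately show "g \<otimes>\<^bsub>BijGroup ?S\<^esub> h \<in> carrier (GL R M)"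
      using gh by (auto simp: GL_def BijGroup_def compose_Bij compose_eq)
  qed
  then have "group ((BijGroup ?S)\<lparr>carrier := carrier (GL R M)\<rparr>)"
    by (rule B.subgroup_imp_group)
  then show ?thesis by (simp add: GL_def)
qed

lemma Omega1_simps [simp]:
  "f \<oplus>\<^bsub>Omega1 G\<^esub> h = f + h" "\<zero>\<^bsub>Omega1 G\<^esub> = 0" "c \<odot>\<^bsub>Omega1 G\<^esub> f = (\<lambda>e. c * f e)"
  by (simp_all add: Omega1_def)

lemma module_Omega1: "module real_field (Omega1 G)"
proof (rule moduleI)
  show "cring real_field" by (rule cring_from_type_algebra)
  show "abelian_group (Omega1 G)"
  proof (rule abelian_groupI)
    fix f assume "f \<in> carrier (Omega1 G)"
    then show "\<exists>h\<in>carrier (Omega1 G). h \<oplus>\<^bsub>Omega1 G\<^esub> f = \<zero>\<^bsub>Omega1 G\<^esub>"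
      by (intro bexI[of _ "- f"]) (auto simp: Omega1_def)
  next
    fix f h assume "f \<in> carrier (Omega1 G)" "h \<in> carrier (Omega1 G)"
    then show "f \<oplus>\<^bsub>Omega1 G\<^esub> h \<in> carrier (Omega1 G)"
      unfolding Omega1_def by (fastforce simp: algebra_simps)
  qed (auto simp: Omega1_def algebra_simps)
next
  fix c f assume "f \<in> carrier (Omega1 G)"
  then show "c \<odot>\<^bsub>Omega1 G\<^esub> f \<in> carrier (Omega1 G)"
    unfolding Omega1_def by (auto split: prod.splits)
qed (auto simp: fun_eq_iff algebra_simps)

lemma carrier_quotient_module: "carrier (quotient_module M N) = a_rcosets\<^bsub>M\<^esub> N"
  by (simp add: quotient_module_def)

lemma module_quotient_module:
  assumes "submodule N R M" "module R M"
  shows "module R (quotient_module M N)"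
    and "\<And>c x. c \<in> carrier R \<Longrightarrow> x \<in> carrier M \<Longrightarrow>
      c \<odot>\<^bsub>quotient_module M N\<^esub> (N +>\<^bsub>M\<^esub> x) = N +>\<^bsub>M\<^esub> (c \<odot>\<^bsub>M\<^esub> x)"
    and "\<And>x y. x \<in> carrier M \<Longrightarrow> y \<in> carrier M \<Longrightarrow>
      (N +>\<^bsub>M\<^esub> x) \<oplus>\<^bsub>quotient_module M N\<^esub> (N +>\<^bsub>M\<^esub> y) = N +>\<^bsub>M\<^esub> (x \<oplus>\<^bsub>M\<^esub> y)"
proof -
  interpret M: module R M by fact
  interpret N: submodule N R M by fact
  let ?Q = "quotient_module M N"
  interpret N: abelian_subgroup N M
    by (rule abelian_subgroupI3)
       (use N.subgroup_axioms M.abelian_group_axioms in \<open>simp_all only: additive_subgroup_def\<close>)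
  have rep: "\<exists>x\<in>carrier M. C = N +>\<^bsub>M\<^esub> x" if "C \<in> carrier ?Q" for C
    using that by (auto simp: carrier_quotient_module A_RCOSETS_def' )
  have repI: "N +>\<^bsub>M\<^esub> x \<in> carrier ?Q" if "x \<in> carrier M" for x
    using that by (auto simp: carrier_quotient_module A_RCOSETS_def')
  show add: "(N +>\<^bsub>M\<^esub> x) \<oplus>\<^bsub>?Q\<^esub> (N +>\<^bsub>M\<^esub> y) = N +>\<^bsub>M\<^esub> (x \<oplus>\<^bsub>M\<^esub> y)"
    if "x \<in> carrier M" "y \<in> carrier M" for x y
    using that by (simp add: quotient_module_def N.a_rcos_sum)
  show smult: "c \<odot>\<^bsub>?Q\<^esub> (N +>\<^bsub>M\<^esub> x) = N +>\<^bsub>M\<^esub> (c \<odot>\<^bsub>M\<^esub> x)"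
    if c: "c \<in> carrier R" and x: "x \<in> carrier M" for c x
  proof -
    have "N +>\<^bsub>M\<^esub> (c \<odot>\<^bsub>M\<^esub> y) = N +>\<^bsub>M\<^esub> (c \<odot>\<^bsub>M\<^esub> x)" if y: "y \<in> N +>\<^bsub>M\<^esub> x" for y
    proof -
      obtain n where n: "n \<in> N" "y = n \<oplus>\<^bsub>M\<^esub> x" using y by (auto simp: a_r_coset_def')
      then have "n \<in> carrier M" by (simp add: N.a_Hcarr)
      then have "c \<odot>\<^bsub>M\<^esub> y = c \<odot>\<^bsub>M\<^esub> n \<oplus>\<^bsub>M\<^esub> c \<odot>\<^bsub>M\<^esub> x" using c x n by (simp add: M.smult_r_distr)
      moreover have "c \<odot>\<^bsub>M\<^esub> n \<in> N" using c n by (simp add: N.smult_closed)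
      ultimately have "c \<odot>\<^bsub>M\<^esub> y \<in> N +>\<^bsub>M\<^esub> (c \<odot>\<^bsub>M\<^esub> x)" by (auto simp: a_r_coset_def')
      then show ?thesis
        using M.a_repr_independence[OF _ M.smult_closed[OF c x] N.a_subgroup] by simp
    qed
    moreover have "x \<in> N +>\<^bsub>M\<^esub> x" using x by (rule N.a_rcos_self)
    ultimately have "(\<Union>y\<in>N +>\<^bsub>M\<^esub> x. N +>\<^bsub>M\<^esub> (c \<odot>\<^bsub>M\<^esub> y)) = N +>\<^bsub>M\<^esub> (c \<odot>\<^bsub>M\<^esub> x)" by blast
    then show ?thesis by (simp add: quotient_module_def)
  qed
  show "module R ?Q"
  proof (rule moduleI)
    show "cring R" by (rule M.R.is_cring)
    have "subgroup N (add_monoid M)" by (rule N.a_subgroup)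
    then have zero: "\<zero>\<^bsub>?Q\<^esub> = N +>\<^bsub>M\<^esub> \<zero>\<^bsub>M\<^esub>"
      by (simp add: quotient_module_def M.a_coset_join2 subgroup.one_closed[of N "add_monoid M", simplified])
    show "abelian_group ?Q"
    proof (rule abelian_groupI)
      fix C assume "C \<in> carrier ?Q"
      then obtain x where "x \<in> carrier M" "C = N +>\<^bsub>M\<^esub> x" using rep by blast
      then show "\<exists>D\<in>carrier ?Q. D \<oplus>\<^bsub>?Q\<^esub> C = \<zero>\<^bsub>?Q\<^esub>"
        by (intro bexI[of _ "N +>\<^bsub>M\<^esub> (\<ominus>\<^bsub>M\<^esub> x)"]) (simp_all add: add zero M.l_neg repI)
    qed (auto dest!: rep intro!: repI simp: add zero M.a_ac)
  next
    fix c C assume "c \<in> carrier R" "C \<in> carrier ?Q"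
    then show "c \<odot>\<^bsub>?Q\<^esub> C \<in> carrier ?Q"
      using rep[of C] by (auto simp: smult intro!: repI)
  next
    fix a b C assume "a \<in> carrier R" "b \<in> carrier R" "C \<in> carrier ?Q"
    then show "(a \<oplus>\<^bsub>R\<^esub> b) \<odot>\<^bsub>?Q\<^esub> C = a \<odot>\<^bsub>?Q\<^esub> C \<oplus>\<^bsub>?Q\<^esub> b \<odot>\<^bsub>?Q\<^esub> C"
      using rep[of C] by (auto simp: smult add M.smult_l_distr)
  next
    fix a C D assume "a \<in> carrier R" "C \<in> carrier ?Q" "D \<in> carrier ?Q"
    then show "a \<odot>\<^bsub>?Q\<^esub> (C \<oplus>\<^bsub>?Q\<^esub> D) = a \<odot>\<^bsub>?Q\<^esub> C \<oplus>\<^bsub>?Q\<^esub> a \<odot>\<^bsub>?Q\<^esub> D"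
      using rep[of C] rep[of D] by (auto simp: smult add M.smult_r_distr)
  next
    fix a b C assume "a \<in> carrier R" "b \<in> carrier R" "C \<in> carrier ?Q"
    then show "(a \<otimes>\<^bsub>R\<^esub> b) \<odot>\<^bsub>?Q\<^esub> C = a \<odot>\<^bsub>?Q\<^esub> (b \<odot>\<^bsub>?Q\<^esub> C)"
      using rep[of C] by (auto simp: smult M.smult_assoc1)
  next
    fix C assume "C \<in> carrier ?Q"
    then show "\<one>\<^bsub>R\<^esub> \<odot>\<^bsub>?Q\<^esub> C = C"
      using rep[of C] by (auto simp: smult)
  qed
qed

lemma (in pair_graph) sym_arc: "(v, w) \<in> parcs G \<Longrightarrow> (w, v) \<in> parcs G"
  using pair_sym_arcs by (auto simp: symmetric_def sym_def)

lemma (in pair_graph) submodule_coboundary: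
  "submodule (range (coboundary G)) real_field (Omega1 G)"
proof -
  interpret module real_field "Omega1 G" by (rule module_Omega1)
  have sub: "range (coboundary G) \<subseteq> carrier (Omega1 G)"
    by (auto simp: coboundary_def Omega1_def sym_arc)
  have smult: "(\<lambda>e. c * coboundary G u e) = coboundary G (\<lambda>v. c * u v)" for c u
    by (auto simp: coboundary_def fun_eq_iff algebra_simps)
  have add: "coboundary G u + coboundary G v = coboundary G (u + v)" for u v
    by (auto simp: coboundary_def fun_eq_iff)
  have zero: "0 = coboundary G (\<lambda>_. 0)"
    by (auto simp: coboundary_def fun_eq_iff)
  show ?thesis
  proof (rule submoduleI)
    fix f assume "f \<in> range (coboundary G)"
    then obtain u where f: "f = coboundary G u" by blast
    have "\<ominus>\<^bsub>Omega1 G\<^esub> f = coboundary G (- u)"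
    proof (rule minus_equality)
      show "coboundary G (- u) \<oplus>\<^bsub>Omega1 G\<^esub> f = \<zero>\<^bsub>Omega1 G\<^esub>"
        by (auto simp: f coboundary_def fun_eq_iff)
    qed (use sub f in auto)
    then show "\<ominus>\<^bsub>Omega1 G\<^esub> f \<in> range (coboundary G)" by simp
  qed (use sub in \<open>auto simp: smult add zero\<close>)
qed

lemma (in pair_graph) module_H1: "module real_field (H1 G)"
  unfolding H1_def by (intro module_quotient_module submodule_coboundary module_Omega1)

lemma carrier_H1:
  "C \<in> carrier (H1 G) \<longleftrightarrow> (\<exists>f\<in>carrier (Omega1 G). C = range (coboundary G) +>\<^bsub>Omega1 G\<^esub> f)"
  by (auto simp: H1_def carrier_quotient_module A_RCOSETS_def')

lemma Aut_arc:
  assumes "g \<in> carrier (Aut G)" "v \<in> pverts G" "w \<in> pverts G"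
  shows "(g v, g w) \<in> parcs G \<longleftrightarrow> (v, w) \<in> parcs G"
  using assms by (auto simp: Aut_def)

context pair_graph
begin

lemma pullback_in_Omega1:
  assumes "g \<in> carrier (Aut G)" "f \<in> carrier (Omega1 G)"
  shows "pullback G g f \<in> carrier (Omega1 G)"
  using assms by (fastforce simp: Omega1_def pullback_def sym_arc Aut_arc wellformed')

lemma pullback_coboundary:
  assumes "g \<in> carrier (Aut G)"
  shows "pullback G g (coboundary G u) = coboundary G (u \<circ> g)"
  using assms by (auto simp: pullback_def coboundary_def fun_eq_iff Aut_arc wellformed')

lemma pullback_add: "pullback G g (f + h) = pullback G g f + pullback G g h"
  by (auto simp: pullback_def fun_eq_iff)

lemma pullback_smult: "pullback G g (\<lambda>e. c * f e) = (\<lambda>e. c * pullback G g f e)"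
  by (auto simp: pullback_def fun_eq_iff)

lemma pullback_mult:
  assumes "g \<in> carrier (Aut G)" "h \<in> carrier (Aut G)"
  shows "pullback G (g \<otimes>\<^bsub>Aut G\<^esub> h) f = pullback G h (pullback G g f)"
proof -
  have "(g \<otimes>\<^bsub>Aut G\<^esub> h) v = g (h v)" if "v \<in> pverts G" for v
    using that assms by (simp add: Aut_def BijGroup_def compose_eq)
  then show ?thesis
    using Aut_arc[OF assms(2)] by (auto simp: pullback_def fun_eq_iff wellformed')
qed

lemma pullback_one:
  assumes "f \<in> carrier (Omega1 G)"
  shows "pullback G \<one>\<^bsub>Aut G\<^esub> f = f"
  using assms by (auto simp: pullback_def fun_eq_iff Aut_def BijGroup_def Omega1_def wellformed')

lemma pullback_H1_class:
  assumes g: "g \<in> carrier (Aut G)" and f: "f \<in> carrier (Omega1 G)"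
  shows "pullback_H1 G g (range (coboundary G) +>\<^bsub>Omega1 G\<^esub> f) =
    range (coboundary G) +>\<^bsub>Omega1 G\<^esub> pullback G g f"
proof -
  interpret M: module real_field "Omega1 G" by (rule module_Omega1)
  interpret B: submodule "range (coboundary G)" real_field "Omega1 G" by (rule submodule_coboundary)
  interpret B: abelian_subgroup "range (coboundary G)" "Omega1 G"
    by (rule abelian_subgroupI3)
       (use B.subgroup_axioms M.abelian_group_axioms in \<open>simp_all only: additive_subgroup_def\<close>)
  let ?C = "range (coboundary G) +>\<^bsub>Omega1 G\<^esub> f"
  have "range (coboundary G) +>\<^bsub>Omega1 G\<^esub> pullback G g h =
      range (coboundary G) +>\<^bsub>Omega1 G\<^esub> pullback G g f" if h: "h \<in> ?C" for h
  proof -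
    obtain u where "h = coboundary G u + f" using h by (auto simp: a_r_coset_def')
    then have "pullback G g h = coboundary G (u \<circ> g) + pullback G g f"
      using g by (simp add: pullback_add pullback_coboundary)
    then have "pullback G g h \<in> range (coboundary G) +>\<^bsub>Omega1 G\<^esub> pullback G g f"
      by (auto simp: a_r_coset_def')
    then show ?thesis
      using M.a_repr_independence[OF _ pullback_in_Omega1[OF g f] B.a_subgroup] by simp
  qed
  moreover have "f \<in> ?C" using f by (rule B.a_rcos_self)
  ultimately have "(\<Union>h\<in>?C. range (coboundary G) +>\<^bsub>Omega1 G\<^esub> pullback G g h) =
      range (coboundary G) +>\<^bsub>Omega1 G\<^esub> pullback G g f"
    by blast
  moreover have "?C \<in> carrier (H1 G)" using f by (auto simp: carrier_H1)
  ultimately show ?thesis by (simp add: pullback_H1_def)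
qed

lemma pullback_H1_closed:
  assumes "g \<in> carrier (Aut G)" "C \<in> carrier (H1 G)"
  shows "pullback_H1 G g C \<in> carrier (H1 G)"
  using assms by (auto simp: carrier_H1 pullback_H1_class intro: pullback_in_Omega1)

lemma pullback_H1_mult:
  assumes "g \<in> carrier (Aut G)" "h \<in> carrier (Aut G)" "C \<in> carrier (H1 G)"
  shows "pullback_H1 G (g \<otimes>\<^bsub>Aut G\<^esub> h) C = pullback_H1 G h (pullback_H1 G g C)"
proof -
  interpret A: group "Aut G" by (rule group_Aut)
  show ?thesis
    using assms by (auto simp: carrier_H1 pullback_H1_class pullback_in_Omega1 pullback_mult)
qed

lemma pullback_H1_one:
  assumes "C \<in> carrier (H1 G)"
  shows "pullback_H1 G \<one>\<^bsub>Aut G\<^esub> C = C"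
proof -
  interpret A: group "Aut G" by (rule group_Aut)
  show ?thesis
    using assms by (auto simp: carrier_H1 pullback_H1_class pullback_one)
qed

lemma pullback_H1_GL:
  assumes g: "g \<in> carrier (Aut G)"
  shows "pullback_H1 G g \<in> carrier (GL real_field (H1 G))"
proof -
  interpret A: group "Aut G" by (rule group_Aut)
  interpret M: module real_field "Omega1 G" by (rule module_Omega1)
  note Q = module_quotient_module(2,3)[OF submodule_coboundary module_Omega1, folded H1_def]
  have "bij_betw (pullback_H1 G g) (carrier (H1 G)) (carrier (H1 G))"
  proof (rule bij_betw_byWitness[where f' = "pullback_H1 G (inv\<^bsub>Aut G\<^esub> g)"])
    show "\<forall>C\<in>carrier (H1 G). pullback_H1 G (inv\<^bsub>Aut G\<^esub> g) (pullback_H1 G g C) = C"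
      using g by (simp flip: pullback_H1_mult add: pullback_H1_one)
    show "\<forall>C\<in>carrier (H1 G). pullback_H1 G g (pullback_H1 G (inv\<^bsub>Aut G\<^esub> g) C) = C"
      using g by (simp flip: pullback_H1_mult add: pullback_H1_one)
  qed (use g in \<open>auto intro: pullback_H1_closed\<close>)
  then have "pullback_H1 G g \<in> Bij (carrier (H1 G))"
    by (simp add: Bij_def pullback_H1_def)
  moreover have "pullback_H1 G g (C \<oplus>\<^bsub>H1 G\<^esub> D) = pullback_H1 G g C \<oplus>\<^bsub>H1 G\<^esub> pullback_H1 G g D"
    if CD: "C \<in> carrier (H1 G)" "D \<in> carrier (H1 G)" for C D
  proof -
    obtain f h where f: "f \<in> carrier (Omega1 G)" "C = range (coboundary G) +>\<^bsub>Omega1 G\<^esub> f"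
      and h: "h \<in> carrier (Omega1 G)" "D = range (coboundary G) +>\<^bsub>Omega1 G\<^esub> h"
      using CD by (auto simp: carrier_H1)
    moreover have "f + h \<in> carrier (Omega1 G)" using M.a_closed[OF f(1) h(1)] by simp
    ultimately show ?thesis
      using g by (simp add: Q pullback_H1_class pullback_in_Omega1 pullback_add)
  qed
  moreover have "pullback_H1 G g (c \<odot>\<^bsub>H1 G\<^esub> C) = c \<odot>\<^bsub>H1 G\<^esub> pullback_H1 G g C"
    if C: "C \<in> carrier (H1 G)" for c C
  proof -
    obtain f where f: "f \<in> carrier (Omega1 G)" "C = range (coboundary G) +>\<^bsub>Omega1 G\<^esub> f"
      using C by (auto simp: carrier_H1)
    moreover have "(\<lambda>e. c * f e) \<in> carrier (Omega1 G)" using M.smult_closed[of c f] f(1) by simp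
    ultimately show ?thesis
      using g by (simp add: Q pullback_H1_class pullback_in_Omega1 pullback_smult)
  qed
  ultimately show ?thesis by (simp add: GL_def)
qed

lemma phi1_hom: "phi1 G \<in> hom (Aut G) (GL real_field (H1 G))"
proof (rule homI)
  interpret L: group "GL real_field (H1 G)" by (rule group_GL[OF module_H1])
  fix g assume g: "g \<in> carrier (Aut G)"
  then show "phi1 G g \<in> carrier (GL real_field (H1 G))"
    by (simp add: phi1_def pullback_H1_GL)
  fix h assume h: "h \<in> carrier (Aut G)"
  have "pullback_H1 G g \<in> Bij (carrier (H1 G))" "pullback_H1 G h \<in> Bij (carrier (H1 G))"
    using g h pullback_H1_GL by (auto simp: GL_def)
  moreover have "pullback_H1 G (g \<otimes>\<^bsub>Aut G\<^esub> h) =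
      compose (carrier (H1 G)) (pullback_H1 G h) (pullback_H1 G g)"
  proof
    fix C show "pullback_H1 G (g \<otimes>\<^bsub>Aut G\<^esub> h) C =
        compose (carrier (H1 G)) (pullback_H1 G h) (pullback_H1 G g) C"
      using pullback_H1_mult[OF g h]
      by (cases "C \<in> carrier (H1 G)") (auto simp: compose_def pullback_H1_def)
  qed
  ultimately have "pullback_H1 G (g \<otimes>\<^bsub>Aut G\<^esub> h) =
      pullback_H1 G h \<otimes>\<^bsub>GL real_field (H1 G)\<^esub> pullback_H1 G g"
    by (simp add: GL_def BijGroup_def)
  then show "phi1 G (g \<otimes>\<^bsub>Aut G\<^esub> h) = phi1 G g \<otimes>\<^bsub>GL real_field (H1 G)\<^esub> phi1 G h"
    using g h by (simp add: phi1_def L.inv_mult_group pullback_H1_GL)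
qed

end

end

theory Submission
  imports Defs
begin

text \<open>
  If \<open>g\<close> acts trivially on \<open>H\<^sup>1\<close>, then dually it preserves every circulation. Suppose \<open>g\<close> moves an
  arc \<open>e\<close> that carries a circulation. Since the class of the indicator form of \<open>e\<close> is invariant,
  \<open>e\<close> and \<open>g e\<close> form an edge cut, and the images of \<open>e\<close> under the powers of \<open>g\<close> cut the graph
  into pieces that \<open>g\<close> permutes cyclically. A circulation that avoids \<open>e\<close>, which exists
  because \<open>b\<^sub>1 \<ge> 2\<close>, splits into its invariant restrictions to the pieces, so it vanishes. Hence \<open>g\<close>
  fixes every arc that carries a circulation. By the degree condition, every arc leaving a fixed
  vertex extends to a path that ends on a cycle, hence at a fixed vertex; the path and its image
  differ by a circulation, so they start with the same arc. Thus fixedness spreads to all neighbours.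
\<close>

section \<open>Oriented indicators of arc lists\<close>

lemma cycle_form_Nil [simp]: "cycle_form [] = 0"
  by (simp add: cycle_form_def fun_eq_iff)

lemma cycle_form_append [simp]: "cycle_form (p @ q) = cycle_form p + cycle_form q"
  by (simp add: cycle_form_def fun_eq_iff)

lemma cycle_form_eq_0: "(x, y) \<notin> set p \<Longrightarrow> (y, x) \<notin> set p \<Longrightarrow> cycle_form p (x, y) = 0"
  by (simp add: cycle_form_def count_list_0_iff)

lemma cycle_form_Cons: "cycle_form (e # p) = cycle_form [e] + cycle_form p"
  using cycle_form_append[of "[e]" p] by simp

lemma cycle_form_single:
  "cycle_form [(a, b)] (x, y) = of_bool (x = a \<and> y = b) - of_bool (x = b \<and> y = a)"
  unfolding cycle_form_def
  by (cases "x = a"; cases "y = b"; cases "x = b"; cases "y = a") simp_all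

lemma cycle_form_single_self:
  "a \<noteq> b \<Longrightarrow> cycle_form [(a, b)] (a, b) = 1" "a \<noteq> b \<Longrightarrow> cycle_form [(a, b)] (b, a) = - 1"
  by (simp_all add: cycle_form_single)

lemma cycle_form_single_other:
  assumes "(x, y) \<noteq> (a, b)" "(x, y) \<noteq> (b, a)"
  shows "cycle_form [(a, b)] (x, y) = 0"
  by (rule cycle_form_eq_0) (use assms in auto)

lemma cycle_form_antisym: "cycle_form p (x, y) = - cycle_form p (y, x)"
  by (simp add: cycle_form_def)

section \<open>Circulations\<close>

context pair_graph
begin

text \<open>Kirchhoff's law at every vertex: the orthogonal complement of the coboundaries in
  \<open>Omega1 G\<close>, on which triviality on cohomology is tested dually.\<close>

definition circulation :: "('a \<times> 'a \<Rightarrow> real) \<Rightarrow> bool" where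
  "circulation z \<longleftrightarrow> z \<in> carrier (Omega1 G) \<and> (\<forall>v\<in>pverts G. (\<Sum>w\<in>pverts G. z (v, w)) = 0)"

lemma finite_pverts: "finite (pverts G)"
  by (rule pair_finite_verts)

lemma Omega1_iff:
  "f \<in> carrier (Omega1 G) \<longleftrightarrow>
    (\<forall>(v, w)\<in>parcs G. f (v, w) = - f (w, v)) \<and> (\<forall>e. e \<notin> parcs G \<longrightarrow> f e = 0)"
  unfolding Omega1_def partial_object.simps mem_Collect_eq by (rule refl)

lemma Omega1I:
  assumes "\<And>v w. f (v, w) = - f (w, v)" "\<And>e. e \<notin> parcs G \<Longrightarrow> f e = 0"
  shows "f \<in> carrier (Omega1 G)"
  unfolding Omega1_iff using assms by blast

lemma Omega1_off_arcs: "f \<in> carrier (Omega1 G) \<Longrightarrow> e \<notin> parcs G \<Longrightarrow> f e = 0"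
  unfolding Omega1_iff by blast

lemma Omega1_antisym:
  assumes "f \<in> carrier (Omega1 G)"
  shows "f (v, w) = - f (w, v)"
proof (cases "(v, w) \<in> parcs G")
  case True
  then show ?thesis using assms unfolding Omega1_iff by blast
next
  case False
  then have "(w, v) \<notin> parcs G" using sym_arc by blast
  then show ?thesis using False Omega1_off_arcs[OF assms] by simp
qed

lemma circulationI:
  assumes "\<And>v w. z (v, w) = - z (w, v)" "\<And>e. e \<notin> parcs G \<Longrightarrow> z e = 0"
    and "\<And>v. v \<in> pverts G \<Longrightarrow> (\<Sum>w\<in>pverts G. z (v, w)) = 0"
  shows "circulation z"
  unfolding circulation_def using Omega1I[of z] assms by blast

lemma circulation_antisym: "circulation z \<Longrightarrow> z (v, w) = - z (w, v)"
  by (rule Omega1_antisym) (simp add: circulation_def)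

lemma circulation_off_arcs: "circulation z \<Longrightarrow> e \<notin> parcs G \<Longrightarrow> z e = 0"
  by (simp add: circulation_def Omega1_off_arcs)

lemma circulation_arc: "circulation z \<Longrightarrow> z e \<noteq> 0 \<Longrightarrow> e \<in> parcs G"
  using circulation_off_arcs by blast

lemma sum_circulation: "circulation z \<Longrightarrow> v \<in> pverts G \<Longrightarrow> (\<Sum>w\<in>pverts G. z (v, w)) = 0"
  by (simp add: circulation_def)

lemma circulation_diff:
  assumes "circulation z" "circulation z'"
  shows "circulation (\<lambda>e. c * z e - c' * z' e)"
proof (rule circulationI)
  show "c * z (v, w) - c' * z' (v, w) = - (c * z (w, v) - c' * z' (w, v))" for v w
    using circulation_antisym[OF assms(1), of v w] circulation_antisym[OF assms(2), of v w] by simp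
  show "c * z e - c' * z' e = 0" if "e \<notin> parcs G" for e
    using that assms by (simp add: circulation_off_arcs)
  show "(\<Sum>w\<in>pverts G. c * z (v, w) - c' * z' (v, w)) = 0" if "v \<in> pverts G" for v
    using that assms[THEN sum_circulation]
    by (simp add: sum_subtractf flip: sum_distrib_left)
qed

text \<open>Summation by parts: each \<open>u v\<close> gets multiplied by the net flow at
  \<open>v\<close>, which is zero.\<close>

lemma sum_circulation_coboundary:
  assumes z: "circulation z"
  shows "(\<Sum>v\<in>pverts G. \<Sum>w\<in>pverts G. z (v, w) * coboundary G u (v, w)) = 0"
proof -
  have eq: "z (v, w) * coboundary G u (v, w) = u w * z (v, w) - u v * z (v, w)" for v w
    using circulation_arc[OF z, of "(v, w)"] by (auto simp: coboundary_def algebra_simps)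
  have out: "(\<Sum>w\<in>pverts G. z (v, w)) = 0" if "v \<in> pverts G" for v
    using z that by (simp add: circulation_def)
  have "(\<Sum>v\<in>pverts G. z (v, w)) = 0" if "w \<in> pverts G" for w
    using out[OF that] by (subst circulation_antisym[OF z]) (simp add: sum_negf)
  moreover have "(\<Sum>v\<in>pverts G. \<Sum>w\<in>pverts G. u w * z (v, w)) =
      (\<Sum>w\<in>pverts G. u w * (\<Sum>v\<in>pverts G. z (v, w)))"
    by (subst sum.swap) (simp add: sum_distrib_left)
  moreover have "(\<Sum>v\<in>pverts G. \<Sum>w\<in>pverts G. u v * z (v, w)) =
      (\<Sum>v\<in>pverts G. u v * (\<Sum>w\<in>pverts G. z (v, w)))"
    by (simp add: sum_distrib_left)
  ultimately show ?thesis by (simp add: eq sum_subtractf out)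
qed

text \<open>The factor 2 appears because the pairing runs over ordered pairs and both orientations
  of an edge contribute \<open>z (a, b)\<close>.\<close>

lemma sum_circulation_single:
  assumes z: "circulation z" and ab: "a \<in> pverts G" "b \<in> pverts G"
  shows "(\<Sum>v\<in>pverts G. \<Sum>w\<in>pverts G. z (v, w) * cycle_form [(a, b)] (v, w)) = 2 * z (a, b)"
proof -
  have *: "(\<Sum>v\<in>pverts G. \<Sum>w\<in>pverts G. z (v, w) * of_bool (v = a \<and> w = b)) = z (a, b)"
    if "a \<in> pverts G" "b \<in> pverts G" for a b
  proof -
    have "z (v, w) * of_bool (v = a \<and> w = b) =
        (if w = b then if v = a then z (a, b) else 0 else 0)" for v w
      by simp
    then show ?thesis using that finite_pverts by simp
  qed
  show ?thesis
    using *[OF ab] *[OF ab(2,1)] circulation_antisym[OF z, of b a]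
    by (simp add: cycle_form_single right_diff_distrib sum_subtractf)
qed

text \<open>Telescoping: passing through a vertex contributes 1 for the departure and -1 for the
  arrival, so only the two ends remain.\<close>

lemma sum_cycle_form:
  assumes "awalk u p v" "y \<in> pverts G"
  shows "(\<Sum>w\<in>pverts G. cycle_form p (y, w)) = of_bool (y = u) - of_bool (y = v)"
  using assms(1)
proof (induction p arbitrary: u)
  case Nil
  then show ?case by (simp add: awalk_Nil_iff)
next
  case (Cons e p)
  obtain a b where e: "e = (a, b)" by (cases e)
  have ab: "(a, b) \<in> parcs G" "u = a" "awalk b p v" using Cons.prems by (auto simp: e awalk_Cons_iff)
  have "cycle_form [(a, b)] (y, w) =
      (if w = b then of_bool (y = a) else 0) - (if w = a then of_bool (y = b) else 0)" for w
    by (simp add: cycle_form_single)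
  then have "(\<Sum>w\<in>pverts G. cycle_form [(a, b)] (y, w)) = of_bool (y = a) - of_bool (y = b)"
    using ab finite_pverts by (simp add: sum_subtractf wellformed')
  then show ?case
    using Cons.IH[OF ab(3)] ab(2) by (simp add: e cycle_form_Cons[of _ p] sum.distrib)
qed

lemma cycle_form_off_arcs:
  assumes "set p \<subseteq> parcs G" "e \<notin> parcs G"
  shows "cycle_form p e = 0"
proof (cases e)
  case (Pair x y)
  then have "(x, y) \<notin> set p" "(y, x) \<notin> set p" using assms sym_arc by blast+
  then show ?thesis by (simp add: Pair cycle_form_eq_0)
qed

lemma circulation_closed_walk:
  assumes "awalk u p u"
  shows "circulation (cycle_form p)"
proof (rule circulationI)
  show "cycle_form p e = 0" if "e \<notin> parcs G" for e
    using assms that by (intro cycle_form_off_arcs) (auto simp: awalk_def)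
qed (use sum_cycle_form[OF assms] in \<open>auto intro: cycle_form_antisym\<close>)

lemma circulation_cycle:
  assumes "cycle p"
  shows "circulation (cycle_form p)"
  using assms circulation_closed_walk by (auto simp: cycle_def)

lemma circulation_diff_walks:
  assumes p: "awalk u p v" and q: "awalk u q v"
  shows "circulation (\<lambda>e. cycle_form p e - cycle_form q e)"
proof (rule circulationI)
  show "cycle_form p e - cycle_form q e = 0" if "e \<notin> parcs G" for e
    using assms that by (simp add: cycle_form_off_arcs awalk_def)
  show "cycle_form p (x, y) - cycle_form q (x, y) =
      - (cycle_form p (y, x) - cycle_form q (y, x))" for x y
    using cycle_form_antisym[of p x y] cycle_form_antisym[of q x y] by simp
qed (use sum_cycle_form[OF p] sum_cycle_form[OF q] in \<open>simp add: sum_subtractf\<close>)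

section \<open>Simple paths and connectedness\<close>

lemma apath_start_unique:
  assumes "apath u p v"
  shows "(x, u) \<notin> set p"
proof
  assume "(x, u) \<in> set p"
  then obtain s t where p: "p = (s @ [(x, u)]) @ t" by (auto simp: in_set_conv_decomp)
  have "apath u (s @ [(x, u)]) (last (pawalk_verts u (s @ [(x, u)])))"
    using assms unfolding p by (rule apath_append_iff[THEN iffD1, THEN conjunct1])
  moreover have "last (pawalk_verts u (s @ [(x, u)])) = u"
    using awalk_verts_conv by simp
  ultimately show False using apath_nonempty_ends by fastforce
qed

lemma apath_end_unique:
  assumes "apath u p v"
  shows "(v, x) \<notin> set p"
proof
  assume "(v, x) \<in> set p"
  then obtain s t where p: "p = s @ (v, x) # t" by (auto simp: in_set_conv_decomp)
  have "apath (last (pawalk_verts u s)) ((v, x) # t) v"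
    using assms unfolding p apath_append_iff by blast
  moreover from this have "last (pawalk_verts u s) = v" by (simp add: apath_Cons_iff)
  ultimately show False using apath_nonempty_ends by fastforce
qed

text \<open>Connectedness is defined through the symmetric closure; the arcs are already symmetric,
  so directed reachability permits induction along arcs of \<open>G\<close>.\<close>

lemma connected_closed_set:
  assumes "Digraph_Component.connected (with_proj G)"
    and "x \<in> S" "x \<in> pverts G" "y \<in> pverts G"
    and closed: "\<And>v w. v \<in> S \<Longrightarrow> (v, w) \<in> parcs G \<Longrightarrow> w \<in> S"
  shows "y \<in> S"
proof -
  have "x \<rightarrow>\<^sup>*\<^bsub>with_proj (mk_symmetric (with_proj G))\<^esub> y"
    using assms by (auto simp: connected_def strongly_connected_def)
  then have "x \<rightarrow>\<^sup>*\<^bsub>with_proj G\<^esub> y" using reachable_mk_symmetric_eq[OF pair_sym_arcs] by simp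
  then show ?thesis
  proof (induction rule: reachable_induct)
    case base
    show ?case by (rule assms(2))
  next
    case (step v w)
    then show ?case using closed[of v w] by simp
  qed
qed

text \<open>Pairing \<open>z\<close> with a coboundary supported on two edges leaves only these two
  terms: the net flow across the cut vanishes.\<close>

lemma two_arc_balance:
  assumes z: "circulation z" and arcs: "(a, b) \<in> parcs G" "(c, d) \<in> parcs G"
    and u: "\<And>x y. coboundary G u (x, y) =
      s * cycle_form [(a, b)] (x, y) - t * cycle_form [(c, d)] (x, y)"
  shows "s * z (a, b) = t * z (c, d)"
proof -
  have "s * (2 * z (a, b)) - t * (2 * z (c, d)) =
      (\<Sum>v\<in>pverts G. \<Sum>w\<in>pverts G. z (v, w) * coboundary G u (v, w))"
    unfolding sum_circulation_single[OF z wellformed'[OF arcs(1)], symmetric]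
      sum_circulation_single[OF z wellformed'[OF arcs(2)], symmetric]
    by (simp add: u sum_distrib_left sum_subtractf right_diff_distrib mult.left_commute)
  then show ?thesis by (simp add: sum_circulation_coboundary[OF z])
qed

text \<open>Evaluation at \<open>e\<close> is a single linear functional, so it cannot be injective
  on a space of dimension at least 2. Otherwise one form \<open>z1\<close> would span all
  circulations.\<close>

lemma ex_circulation_vanishing_at:
  assumes "2 \<le> betti1 G"
  shows "\<exists>z. circulation z \<and> z \<noteq> 0 \<and> z e = 0"
proof (rule ccontr)
  assume none: "\<not> ?thesis"
  interpret V: vector_space "\<lambda>(c::real) (f :: 'a \<times> 'a \<Rightarrow> real) e. c * f e"
    by (rule vector_space_pointwise)
  let ?B = "{cycle_form p |p. cycle p \<and> 3 \<le> length p}"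
  have "\<exists>z1. \<forall>z. circulation z \<longrightarrow> z \<in> V.span {z1}"
  proof (cases "\<exists>z1. circulation z1 \<and> z1 e \<noteq> 0")
    case True
    then obtain z1 where z1: "circulation z1" "z1 e \<noteq> 0" by blast
    have "z \<in> V.span {z1}" if z: "circulation z" for z
    proof -
      have "circulation (\<lambda>e'. 1 * z e' - z e / z1 e * z1 e')"
        using z z1(1) by (rule circulation_diff)
      moreover have "1 * z e - z e / z1 e * z1 e = 0" using z1(2) by simp
      ultimately have "(\<lambda>e'. 1 * z e' - z e / z1 e * z1 e') = 0" using none by blast
      then have "z = (\<lambda>e'. z e / z1 e * z1 e')" by (auto simp: fun_eq_iff)
      then show ?thesis by (metis V.span_base V.span_scale singletonI)
    qed
    then show ?thesis by blast
  next
    case False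
    then have "circulation z \<longrightarrow> z \<in> V.span {0}" for z
      using none V.span_zero by metis
    then show ?thesis by blast
  qed
  then obtain z1 where "\<forall>z. circulation z \<longrightarrow> z \<in> V.span {z1}" by blast
  then have "?B \<subseteq> V.span {z1}" using circulation_cycle by blast
  then have "V.dim ?B \<le> card {z1}" by (rule V.dim_le_card) simp
  then show False using assms by (simp add: betti1_def)
qed

text \<open>
  The last vertex \<open>v\<close> of a longest path starting with a given arc has, by the degree condition, a
  neighbour \<open>w\<close> other than its predecessor; by maximality \<open>w\<close> lies on the path.
\<close>

lemma ex_apath_ending_on_cycle:
  assumes deg: "\<forall>v\<in>pverts G. 2 \<le> out_degree (with_proj G) v" and arc: "(a, b) \<in> parcs G"
  shows "\<exists>p v w z. apath a ((a, b) # p) v \<and> (v, w) \<in> parcs G \<and> circulation z \<and> z (v, w) \<noteq> 0"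
proof -
  let ?P = "\<lambda>p. \<exists>v. apath a ((a, b) # p) v"
  have ab: "a \<in> pverts G" "b \<in> pverts G" "a \<noteq> b"
    using arc by (auto simp: wellformed' dest: no_loops')
  have "?P []" using arc ab by (simp add: apath_simps)
  moreover have "length p < card (pverts G)" if "?P p" for p
    using that length_apath_less by fastforce
  ultimately obtain p where p: "?P p" and max: "\<And>q. ?P q \<Longrightarrow> length q \<le> length p"
    using ex_has_greatest_nat[of ?P "[]" length "card (pverts G)"] by blast
  from p obtain v where v: "apath a ((a, b) # p) v" by blast
  let ?p = "(a, b) # p"
  have walk: "awalk a ?p v" using v by (rule awalkI_apath)
  then have last_v: "last (pawalk_verts a ?p) = v" by (rule awlast_of_awalk) simp
  obtain q r where qr: "?p = q @ [(r, v)]"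
  proof -
    obtain q e where qe: "?p = q @ [e]" by (metis list.distinct(1) rev_exhaust)
    moreover have "snd e = v" using last_v unfolding qe awalk_verts_conv by simp
    ultimately show ?thesis using that by (cases e) auto
  qed
  have "v \<in> pverts G" using walk by (rule awalk_last_in_verts)
  then have "2 \<le> card (out_arcs (with_proj G) v)" using deg by (simp add: out_degree_def)
  then have "\<not> out_arcs (with_proj G) v \<subseteq> {(v, r)}"
    using card_mono[of "{(v, r)}" "out_arcs (with_proj G) v"] by auto
  then obtain w where w: "(v, w) \<in> parcs G" "w \<noteq> r" by fastforce
  have "w \<in> set (pawalk_verts a ?p)"
  proof (rule ccontr)
    assume "w \<notin> set (pawalk_verts a ?p)"
    moreover have "apath v [(v, w)] w"
      using w(1) by (auto simp: apath_simps wellformed' dest: no_loops')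
    ultimately have "apath a (?p @ [(v, w)]) w"
      using v last_v unfolding apath_append_iff by simp
    then have "?P (p @ [(v, w)])" by auto
    then show False using max by fastforce
  qed
  then obtain q1 q2 where q: "?p = q1 @ q2" "awalk a q1 w" "awalk w q2 v"
    using awalk_decomp[OF walk] by blast
  then have q2: "apath w q2 v"
    using v awlast_of_awalk[OF q(2)] unfolding q(1) apath_append_iff by simp
  have "v \<noteq> w" using w(1) by (auto dest: no_loops')
  \<comment> \<open>The path meets \<open>v\<close> only at its end, entering from \<open>r\<close>
    rather than \<open>w\<close>. Hence nothing cancels the closing arc \<open>(v, w)\<close> in the
    form of the closed walk.\<close>
  have "(w, v) \<notin> set q2"
  proof
    assume "(w, v) \<in> set q2"
    then obtain s t where st: "q2 = s @ (w, v) # t" by (auto simp: in_set_conv_decomp)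
    have "q2 \<noteq> []" using st by simp
    then have "last q2 = (r, v)" using q(1) qr by (metis last_appendR last_snoc)
    moreover have "t = []"
    proof (rule ccontr)
      assume "t \<noteq> []"
      have "apath (last (pawalk_verts w s)) ((w, v) # t) v" using q2 unfolding st apath_append_iff by blast
      then have "apath v t v" by (simp add: apath_Cons_iff)
      then show False using \<open>t \<noteq> []\<close> apath_nonempty_ends by blast
    qed
    ultimately show False using st w(2) by simp
  qed
  then have "cycle_form (q2 @ [(v, w)]) (v, w) = 1"
    using apath_end_unique[OF q2, of w] \<open>v \<noteq> w\<close> by (simp add: cycle_form_def count_list_0_iff)
  moreover have "awalk w (q2 @ [(v, w)]) w"
    using q(3) w(1) by (intro awalk_appendI[OF q(3)]) (simp add: awalk_simps wellformed')
  ultimately show ?thesis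
    using v w(1) circulation_closed_walk by (metis zero_neq_one)
qed

end

section \<open>Automorphisms acting trivially on cohomology\<close>

locale trivial_on_cohomology = pair_graph G for G :: "'a pair_pre_digraph" +
  fixes g :: "'a \<Rightarrow> 'a"
  assumes conn: "Digraph_Component.connected (with_proj G)"
    and deg: "\<forall>v\<in>pverts G. 2 \<le> out_degree (with_proj G) v"
    and betti: "2 \<le> betti1 G"
    and aut: "g \<in> carrier (Aut G)"
    and trivial: "\<And>f. f \<in> carrier (Omega1 G) \<Longrightarrow> \<exists>u. pullback G g f = coboundary G u + f"
begin

lemma bij_g: "bij_betw g (pverts G) (pverts G)"
  using aut by (simp add: Aut_def Bij_def)

lemma g_vert: "v \<in> pverts G \<Longrightarrow> g v \<in> pverts G"
  using bij_g by (rule bij_betw_apply)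

lemma g_eq_iff: "v \<in> pverts G \<Longrightarrow> w \<in> pverts G \<Longrightarrow> g v = g w \<longleftrightarrow> v = w"
  using bij_g by (meson bij_betw_def inj_on_eq_iff)

lemma g_arc: "(v, w) \<in> parcs G \<Longrightarrow> (g v, g w) \<in> parcs G"
  using Aut_arc[OF aut] wellformed' by blast

text \<open>Triviality is applied to the indicator of the image edge, whose pullback is the
  indicator of \<open>(a, b)\<close>.\<close>

lemma ex_potential:
  assumes ab: "(a, b) \<in> parcs G"
  shows "\<exists>h. \<forall>x y. coboundary G h (x, y) =
    cycle_form [(a, b)] (x, y) - cycle_form [(g a, g b)] (x, y)"
proof -
  let ?f = "cycle_form [(g a, g b)]"
  have "?f \<in> carrier (Omega1 G)"
    using g_arc[OF ab] by (intro Omega1I cycle_form_antisym cycle_form_off_arcs) simp_all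
  then obtain h where h: "pullback G g ?f = coboundary G h + ?f" using trivial by blast
  have "pullback G g ?f (x, y) = cycle_form [(a, b)] (x, y)" for x y
  proof (cases "(x, y) \<in> parcs G")
    case True
    then show ?thesis
      using wellformed'[OF ab] wellformed'[OF True]
      by (simp add: pullback_def cycle_form_single g_eq_iff)
  next
    case False
    then show ?thesis using ab by (simp add: pullback_def cycle_form_off_arcs)
  qed
  then have "coboundary G h (x, y) = cycle_form [(a, b)] (x, y) - ?f (x, y)" for x y
    unfolding h by (simp add: eq_diff_eq)
  then show ?thesis by blast
qed

lemma circulation_invariant:
  assumes "circulation z" "(a, b) \<in> parcs G"
  shows "z (g a, g b) = z (a, b)"
proof -
  obtain h where h: "\<forall>x y. coboundary G h (x, y) =
      cycle_form [(a, b)] (x, y) - cycle_form [(g a, g b)] (x, y)"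
    using ex_potential[OF assms(2)] by blast
  have "1 * z (a, b) = 1 * z (g a, g b)"
    using assms g_arc[OF assms(2)] by (rule two_arc_balance[where u = h]) (simp add: h)
  then show ?thesis by simp
qed

text \<open>
  If \<open>e = (a, b)\<close> carries a circulation and \<open>g\<close> moves it, then \<open>e\<close> and \<open>g e\<close> form an edge cut, with
  potential \<open>h\<close>. A circulation \<open>z\<close> that avoids \<open>e\<close> is supported where \<open>h\<close> does not jump, so \<open>h z\<close> is
  again a circulation, and invariance of \<open>z\<close> and \<open>h z\<close> shows that \<open>h\<close> is constant on the orbit
  of each vertex in the support of \<open>z\<close>. But the set \<open>T\<close> of vertices with this property has no boundary.
\<close>

lemma circulation_support_fixed:
  assumes z1: "circulation z1" "z1 (a, b) \<noteq> 0"
  shows "g a = a \<and> g b = b"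
proof (rule ccontr)
  assume ne: "\<not> (g a = a \<and> g b = b)"
  have arc: "(a, b) \<in> parcs G" using z1 by (rule circulation_arc)
  note arc' = g_arc[OF arc]
  have ab: "a \<in> pverts G" "b \<in> pverts G" "a \<noteq> b" "g a \<noteq> g b"
    using arc arc' by (auto simp: wellformed' dest: no_loops')
  have inv1: "z1 (g a, g b) = z1 (a, b)" using z1(1) arc by (rule circulation_invariant)
  \<comment> \<open>If \<open>g\<close> reversed the edge, invariance and antisymmetry would give
    \<open>z1 (a, b) = 0\<close>.\<close>
  have ne': "\<not> (g a = b \<and> g b = a)"
    using inv1 circulation_antisym[OF z1(1), of a b] z1(2) by auto
  obtain h where h: "\<And>x y. coboundary G h (x, y) =
      cycle_form [(a, b)] (x, y) - cycle_form [(g a, g b)] (x, y)"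
    using ex_potential[OF arc] by blast
  have jump: "h y - h x = cycle_form [(a, b)] (x, y) - cycle_form [(g a, g b)] (x, y)"
    if "(x, y) \<in> parcs G" for x y
    using h[of x y] that by (simp add: coboundary_def)
  note self = cycle_form_single_self[OF ab(3)] cycle_form_single_self[OF ab(4)]
  have other: "cycle_form [(a, b)] (g a, g b) = 0" "cycle_form [(a, b)] (g b, g a) = 0"
    "cycle_form [(g a, g b)] (a, b) = 0" "cycle_form [(g a, g b)] (b, a) = 0"
    by (rule cycle_form_single_other; use ne ne' in auto)+
  have hab: "h b = h a + 1" using jump[OF arc] by (simp add: self other)
  have hgab: "h (g b) = h (g a) - 1" using jump[OF arc'] by (simp add: self other)
  have flat: "h y = h x"
    if "(x, y) \<in> parcs G" "(x, y) \<noteq> (a, b)" "(x, y) \<noteq> (b, a)"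
      "(x, y) \<noteq> (g a, g b)" "(x, y) \<noteq> (g b, g a)" for x y
  proof -
    have "cycle_form [(a, b)] (x, y) = 0" "cycle_form [(g a, g b)] (x, y) = 0"
      using that by (blast intro: cycle_form_single_other)+
    then show ?thesis using jump[OF that(1)] by simp
  qed
  have hg: "h (g b) = h a"
  proof -
    \<comment> \<open>the net outflow of \<open>z1\<close> from the level set of \<open>h\<close> through \<open>a\<close> is zero\<close>
    define k where "k v = (if h v = h a then 1 else 0 :: real)" for v
    have k: "coboundary G k (x, y) = (- 1) * cycle_form [(a, b)] (x, y) -
        (k (g a) - k (g b)) * cycle_form [(g a, g b)] (x, y)" for x y
    proof (cases "(x, y) \<in> parcs G")
      case True
      consider "(x, y) = (a, b) \<or> (x, y) = (b, a) \<or> (x, y) = (g a, g b) \<or> (x, y) = (g b, g a)"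
        | "(x, y) \<noteq> (a, b)" "(x, y) \<noteq> (b, a)" "(x, y) \<noteq> (g a, g b)" "(x, y) \<noteq> (g b, g a)"
        by metis
      then show ?thesis
      proof cases
        case 1
        have "k a = 1" "k b = 0" by (simp_all add: k_def hab)
        then show ?thesis
          using 1 True by (elim disjE) (simp_all add: coboundary_def self other)
      next
        case 2
        then have "k y = k x" using flat[OF True] by (simp add: k_def)
        then show ?thesis
          using True 2 by (simp add: coboundary_def cycle_form_single_other)
      qed
    next
      case False
      then show ?thesis using arc arc' by (simp add: coboundary_def cycle_form_off_arcs)
    qed
    have "(- 1) * z1 (a, b) = (k (g a) - k (g b)) * z1 (g a, g b)"
      using z1(1) arc arc' k by (rule two_arc_balance)
    \<comment> \<open>As \<open>k\<close> only takes the values 0 and 1, this difference forces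
      \<open>k (g b) = 1\<close>.\<close>
    then have "- 1 = k (g a) - k (g b)" unfolding inv1 mult_right_cancel[OF z1(2)] .
    then show ?thesis by (simp add: k_def split: if_splits)
  qed
  obtain z where z: "circulation z" "z \<noteq> 0" "z (a, b) = 0"
    using ex_circulation_vanishing_at[OF betti] by blast
  have hz: "h y = h x" if "z (x, y) \<noteq> 0" for x y
  proof -
    have "z (g a, g b) = 0" using circulation_invariant[OF z(1) arc] z(3) by simp
    then have "z (b, a) = 0" "z (g b, g a) = 0"
      using z(3) circulation_antisym[OF z(1), of b a] circulation_antisym[OF z(1), of "g b" "g a"]
      by simp_all
    then show ?thesis
      using that z(3) \<open>z (g a, g b) = 0\<close> circulation_arc[OF z(1) that] by (intro flat) auto
  qed
  have hzc: "circulation (\<lambda>e. h (fst e) * z e)"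
  proof (rule circulationI)
    show "h (fst (v, w)) * z (v, w) = - (h (fst (w, v)) * z (w, v))" for v w
      using hz[of v w] circulation_antisym[OF z(1), of v w] by (cases "z (v, w) = 0") auto
    show "h (fst e) * z e = 0" if "e \<notin> parcs G" for e
      using that z(1) by (simp add: circulation_off_arcs)
    show "(\<Sum>w\<in>pverts G. h (fst (v, w)) * z (v, w)) = 0" if "v \<in> pverts G" for v
      using that z(1) by (simp add: sum_circulation flip: sum_distrib_left)
  qed
  \<comment> \<open>Invariance of \<open>z\<close> and of \<open>h z\<close> at the same arc; the
    common nonzero factor \<open>z (x, y)\<close> cancels.\<close>
  have step: "h (g x) = h x \<and> z (g x, g y) \<noteq> 0" if nz: "z (x, y) \<noteq> 0" for x y
    using circulation_invariant[OF hzc circulation_arc[OF z(1) nz]]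
      circulation_invariant[OF z(1) circulation_arc[OF z(1) nz]] nz by simp
  obtain x y where xy: "z (x, y) \<noteq> 0" using z(2) by (auto simp: fun_eq_iff)
  have orbit: "h ((g ^^ i) x) = h x \<and> z ((g ^^ i) x, (g ^^ i) y) \<noteq> 0" for i
    by (induction i) (use xy step in auto)
  define T where "T = {v \<in> pverts G. \<forall>i. h ((g ^^ i) v) = h x}"
  have hT: "h v = h x" if "v \<in> T" for v
    using that funpow_0[of g v] unfolding T_def by (metis (mono_tags, lifting) mem_Collect_eq)
  have gT: "g v \<in> T" if "v \<in> T" for v
  proof -
    have "h ((g ^^ i) (g v)) = h x" for i
      using that funpow_Suc_right[of i g] unfolding T_def
      by (metis (mono_tags, lifting) comp_apply mem_Collect_eq)
    then show ?thesis using that g_vert by (simp add: T_def)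
  qed
  have iT: "(g ^^ i) v \<in> T" if "v \<in> T" for v i
    by (induction i) (use that gT in auto)
  have T_sub: "T \<subseteq> pverts G" by (auto simp: T_def)
  \<comment> \<open>Surjectivity allows exclusion from \<open>T\<close> to pass from
    \<open>a\<close> and \<open>b\<close> to their images.\<close>
  have surj: "g ` T = T"
  proof (rule endo_inj_surj)
    show "finite T" using T_sub finite_pverts by (rule finite_subset)
    show "g ` T \<subseteq> T" using gT by blast
    show "inj_on g T" using bij_g T_sub by (meson bij_betw_def inj_on_subset)
  qed
  \<comment> \<open>On \<open>T\<close> the potential is constant, whereas
    \<open>h (g a) = h a + 1\<close> and \<open>h (g b) = h b - 1\<close>.\<close>
  have notT: "a \<notin> T" "b \<notin> T"
    using hT gT hab hgab hg by force+
  have notT': "g a \<notin> T" "g b \<notin> T"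
  proof -
    have "u \<in> T" if "g u \<in> T" "u \<in> pverts G" for u
    proof -
      have "g u \<in> g ` T" using that(1) by (simp add: surj)
      then obtain t where t: "g u = g t" "t \<in> T" by (rule imageE)
      then have "t \<in> pverts G" using T_sub by blast
      then show ?thesis using t g_eq_iff[OF that(2)] by simp
    qed
    from this[OF _ ab(1)] this[OF _ ab(2)] show "g a \<notin> T" "g b \<notin> T" using notT by blast+
  qed
  have "a \<in> T"
  proof (rule connected_closed_set[OF conn])
    show "x \<in> T" using orbit circulation_arc[OF z(1) xy] by (auto simp: T_def wellformed')
    then show "x \<in> pverts G" using T_sub by blast
    show "a \<in> pverts G" by (rule ab)
    fix v w assume vw: "v \<in> T" "(v, w) \<in> parcs G"
    have "h ((g ^^ i) w) = h x" for i
    proof -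
      have "((g ^^ i) v, (g ^^ i) w) \<in> parcs G"
        by (induction i) (use vw(2) g_arc in auto)
      moreover have "(g ^^ i) v \<in> T" using vw(1) by (rule iT)
      \<comment> \<open>All four arcs across which \<open>h\<close> may jump start outside
        \<open>T\<close>, whereas this arc starts in \<open>T\<close>.\<close>
      ultimately have "h ((g ^^ i) w) = h ((g ^^ i) v)"
        using notT notT' by (intro flat) auto
      then show ?thesis using hT \<open>(g ^^ i) v \<in> T\<close> by simp
    qed
    then show "w \<in> T" using vw(2) by (simp add: T_def wellformed')
  qed
  then show False using notT by blast
qed

section \<open>Spreading fixed vertices along walks\<close>

lemma awalk_map:
  assumes "awalk u p v"
  shows "awalk (g u) (map (map_prod g g) p) (g v)"
  using assms
proof (induction p arbitrary: u)
  case Nil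
  then show ?case by (auto simp: awalk_Nil_iff g_vert)
next
  case (Cons e p)
  then show ?case by (cases e) (auto simp: awalk_Cons_iff g_arc)
qed

text \<open>
  A neighbour \<open>w\<close> of a fixed vertex \<open>v\<close> starts a path whose end is fixed as well. If \<open>g\<close> moved \<open>w\<close>,
  this path and its image would differ by a circulation through \<open>(v, w)\<close>.
\<close>

lemma neighbour_fixed:
  assumes v: "g v = v" and arc: "(v, w) \<in> parcs G"
  shows "g w = w"
proof (rule ccontr)
  assume w: "g w \<noteq> w"
  obtain p u u' z where path: "apath v ((v, w) # p) u"
    and "(u, u') \<in> parcs G" "circulation z" "z (u, u') \<noteq> 0"
    using ex_apath_ending_on_cycle[OF deg arc] by blast
  then have u: "g u = u" using circulation_support_fixed by blast
  let ?p = "(v, w) # p"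
  let ?q = "map (map_prod g g) ?p"
  have p: "awalk v ?p u" using path by (rule awalkI_apath)
  have q: "awalk v ?q u" using awalk_map[OF p] by (simp add: v u)
  have verts: "x \<in> pverts G" "y \<in> pverts G" if "(x, y) \<in> set ?p" for x y
    using that p wellformed' unfolding awalk_def by blast+
  have vV: "v \<in> pverts G" using arc by (rule wellformed')
  have start: "(v, y) \<notin> set p" for y
  proof
    assume "(v, y) \<in> set p"
    then have "v \<in> set (pawalk_verts w p)" using awalk_verts_arc1[of "(v, y)" p w] by simp
    then show False using path by (simp add: apath_Cons_iff)
  qed
  have no_return: "(y, v) \<notin> set ?p" for y using path by (rule apath_start_unique)
  have preimage: "\<exists>x y. (x, y) \<in> set ?p \<and> g x = s \<and> g y = t" if "(s, t) \<in> set ?q" for s t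
    using that unfolding set_map by (elim imageE) (metis Pair_inject map_prod_simp surj_pair)
  \<comment> \<open>A preimage would be an arc of the path leaving \<open>v\<close>; the only one is
    the first arc, whose image ends at \<open>g w\<close>, not at \<open>w\<close>.\<close>
  have "(v, w) \<notin> set ?q"
  proof
    assume "(v, w) \<in> set ?q"
    then obtain x y where xy: "(x, y) \<in> set ?p" "g x = v" "g y = w"
      using preimage by blast
    then have "x = v" using g_eq_iff[OF verts(1)[OF xy(1)] vV] v by simp
    then show False using xy start[of y] w by auto
  qed
  moreover have "(w, v) \<notin> set ?q"
  proof
    assume "(w, v) \<in> set ?q"
    then obtain x y where xy: "(x, y) \<in> set ?p" "g x = w" "g y = v"
      using preimage by blast
    then have "y = v" using g_eq_iff[OF verts(2)[OF xy(1)] vV] v by simp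
    then show False using xy no_return by blast
  qed
  ultimately have "cycle_form ?q (v, w) = 0"
    by (rule cycle_form_eq_0)
  moreover have "cycle_form ?p (v, w) = 1"
    using start[of w] no_return[of w] by (simp add: cycle_form_def count_list_0_iff)
  ultimately have "cycle_form ?p (v, w) - cycle_form ?q (v, w) \<noteq> 0" by linarith
  then show False
    using circulation_support_fixed[OF circulation_diff_walks[OF p q]] w by blast
qed

text \<open>A nonzero circulation supplies a first fixed vertex; connectedness carries fixedness to
  all others.\<close>

lemma all_fixed:
  assumes "v \<in> pverts G"
  shows "g v = v"
proof -
  obtain z where z: "circulation z" "z \<noteq> 0"
    using ex_circulation_vanishing_at[OF betti] by blast
  then obtain x y where xy: "z (x, y) \<noteq> 0" by (auto simp: fun_eq_iff)
  have "g x = x" using circulation_support_fixed[OF z(1) xy] by blast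
  then have "x \<in> {v. g v = v}" by simp
  moreover have "x \<in> pverts G" using circulation_arc[OF z(1) xy] by (rule wellformed')
  ultimately have "v \<in> {v. g v = v}"
    using assms by (rule connected_closed_set[OF conn]) (simp add: neighbour_fixed)
  then show ?thesis by simp
qed

lemma eq_one: "g = \<one>\<^bsub>Aut G\<^esub>"
proof -
  have "g \<in> extensional (pverts G)" using aut by (simp add: Aut_def Bij_def)
  \<comment> \<open>Extensionality settles the values off the vertex set.\<close>
  then have "g = (\<lambda>v\<in>pverts G. v)"
    using all_fixed by (auto simp: fun_eq_iff restrict_def extensional_def)
  then show ?thesis by (simp add: Aut_def BijGroup_def)
qed

end

section \<open>From the kernel of \<open>phi1\<close> to cohomologous forms\<close>

lemma (in pair_graph) pullback_cohomologous:
  assumes g: "g \<in> carrier (Aut G)" and phi: "phi1 G g = \<one>\<^bsub>GL real_field (H1 G)\<^esub>"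
    and f: "f \<in> carrier (Omega1 G)"
  shows "\<exists>u. pullback G g f = coboundary G u + f"
proof -
  interpret L: group "GL real_field (H1 G)" by (rule group_GL[OF module_H1])
  interpret M: module real_field "Omega1 G" by (rule module_Omega1)
  interpret B: submodule "range (coboundary G)" real_field "Omega1 G" by (rule submodule_coboundary)
  interpret B: abelian_subgroup "range (coboundary G)" "Omega1 G"
    by (rule abelian_subgroupI3)
       (use B.subgroup_axioms M.abelian_group_axioms in \<open>simp_all only: additive_subgroup_def\<close>)
  let ?C = "\<lambda>f. range (coboundary G) +>\<^bsub>Omega1 G\<^esub> f"
  \<comment> \<open>\<open>phi1 G g\<close> is the inverse of the pullback in a group, so one is the
    identity exactly when the other is.\<close>
  have "pullback_H1 G g = \<one>\<^bsub>GL real_field (H1 G)\<^esub>"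
    using phi pullback_H1_GL[OF g] by (simp add: phi1_def)
  also have "\<dots> = (\<lambda>C\<in>carrier (H1 G). C)" by (simp add: GL_def BijGroup_def)
  finally have "pullback_H1 G g (?C f) = ?C f" using f carrier_H1 by (metis restrict_apply')
  then have "?C (pullback G g f) = ?C f" by (simp add: pullback_H1_class[OF g f])
  moreover have "pullback G g f \<in> ?C (pullback G g f)"
    using pullback_in_Omega1[OF g f] by (rule B.a_rcos_self)
  ultimately show ?thesis by (auto simp: a_r_coset_def')
qed

theorem theorem3p12:
  fixes G :: "'a pair_pre_digraph"
  assumes "pair_graph G"
    and "Digraph_Component.connected (with_proj G)"
    and "\<forall>v\<in>pverts G. 2 \<le> out_degree (with_proj G) v"
    and "2 \<le> betti1 G"
  shows "kernel (Aut G) (GL real_field (H1 G)) (phi1 G) = {\<one>\<^bsub>Aut G\<^esub>} \<and> phi1_image G \<cong> Aut G"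
proof
  interpret pair_graph G by fact
  interpret A: group "Aut G" by (rule group_Aut)
  interpret L: group "GL real_field (H1 G)" by (rule group_GL[OF module_H1])
  interpret phi: group_hom "Aut G" "GL real_field (H1 G)" "phi1 G"
    by unfold_locales (rule phi1_hom)
  have trivial: "g = \<one>\<^bsub>Aut G\<^esub>"
    if "g \<in> carrier (Aut G)" "phi1 G g = \<one>\<^bsub>GL real_field (H1 G)\<^esub>" for g
  proof -
    interpret trivial_on_cohomology G g
      by unfold_locales (use assms that pullback_cohomologous in auto)
    show ?thesis by (rule eq_one)
  qed
  then show "kernel (Aut G) (GL real_field (H1 G)) (phi1 G) = {\<one>\<^bsub>Aut G\<^esub>}"
    by (auto simp: kernel_def)
  \<comment> \<open>The image inherits its multiplication from \<open>GL\<close>, so only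
    injectivity is at stake, and that is triviality of the kernel.\<close>
  have "phi1 G \<in> iso (Aut G) (phi1_image G)"
  proof (rule isoI)
    show "phi1 G \<in> hom (Aut G) (phi1_image G)"
      by (rule homI) (simp_all add: phi1_image_def)
    show "bij_betw (phi1 G) (carrier (Aut G)) (carrier (phi1_image G))"
      using phi.inj_on_one_iff trivial by (auto simp: bij_betw_def phi1_image_def)
  qed
  then show "phi1_image G \<cong> Aut G" by (intro A.iso_sym is_isoI)
qed

end
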